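(* Let $a\in\mathbb{Z}_{\geq 0}$ and $m\in\mathbb{N}$ with $(a,m)\neq(0,1)$, and let $n\geq 2$ be an integer. Then $$\zeta_{\mathcal P_{a+m\mathbb N}}(n)=\Gamma(1+a/m)^{-n}\prod_{r=0}^{n-1}\Gamma\left(1+\frac{a-e(r/n)}{m}\right).$$
   Context: $\mathbb N=\{1,2,3,\dots\}$ and $e(x):=e^{2\pi i x}$; $\Gamma$ is Euler's gamma function. $\mathcal P$ is the set of all integer partitions $\lambda=(\lambda_1\geq\dots\geq\lambda_r\geq1)$, including the empty partition $\emptyset$. For a partition $\lambda$, $n_\lambda:=\lambda_1\lambda_2\cdots\lambda_r$ is the product of its parts, with $n_\emptyset=1$. For $\mathcal M\subset\mathbb N$, $\mathcal P_{\mathcal M}$ is the set of partitions all of whose parts lie in $\mathcal M$ (including $\emptyset$). For $\mathcal P'\subset\mathcal P$ and $s\in\mathbb C$ for which the sum converges, $\zeta_{\mathcal P'}(s):=\sum_{\lambda\in\mathcal P'}n_\lambda^{-s}$. Here $a+m\mathbb N=\{a+mj: j\in\mathbb N\}=\{a+m,a+2m,\dots\}$. *)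

theory Defs
  imports "HOL-Analysis.Analysis"
begin

definition partitions :: "nat list set" where
  "partitions = {ps. sorted_wrt (\<ge>) ps \<and> (\<forall>p \<in> set ps. p \<ge> 1)}"

definition partitions_into :: "nat set \<Rightarrow> nat list set" where
  "partitions_into M = {ps \<in> partitions. set ps \<subseteq> M}"

definition partition_norm :: "nat list \<Rightarrow> nat" where
  "partition_norm ps = prod_list ps"

definition zeta_term :: "complex \<Rightarrow> nat list \<Rightarrow> complex" where
  "zeta_term s ps = of_nat (partition_norm ps) powr (- s)"

text \<open>
  The series is indexed by a set with no preferred order, so it is read as an
  unconditional sum. Where it diverges, \<^const>\<open>infsum\<close> returns the dummy value 0,
  so convergence has to be stated separately.
\<close>

definition partition_zeta_converges :: "nat list set \<Rightarrow> complex \<Rightarrow> bool" where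
  "partition_zeta_converges P s \<longleftrightarrow> zeta_term s summable_on P"

definition partition_zeta :: "nat list set \<Rightarrow> complex \<Rightarrow> complex" where
  "partition_zeta P s = infsum (zeta_term s) P"

text \<open>The index starts at 1, so \<open>a\<close> itself is not a member.\<close>

definition progression :: "nat \<Rightarrow> nat \<Rightarrow> nat set" where
  "progression a m = {a + m * j | j. j \<ge> 1}"

definition e :: "complex \<Rightarrow> complex" where
  "e x = exp (2 * of_real pi * \<i> * x)"

end

theory Submission
  imports Defs "HOL-Computational_Algebra.Fundamental_Theorem_Algebra"
begin

text \<open>
  Grouping partitions by the multiplicities of their parts gives the Euler product: the sum of
  \<open>n_\<lambda>\<^sup>-\<^sup>n\<close> over all partitions with parts in \<open>a + m\<nat>\<close> is the product over these parts \<open>k\<close> of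
  \<open>1 / (1 - k\<^sup>-\<^sup>n)\<close>. Here every \<open>k\<close> is at least \<open>2\<close>, because \<open>(a, m) \<noteq> (0, 1)\<close>. The product is
  established for finitely many parts in \<open>has_sum_partitions_into_finite\<close> and for infinitely many
  in \<open>has_sum_partitions_into_range\<close>; the terms being positive, the latter needs nothing beyond
  convergence of the partial products, which also yields summability.

  On the other side, write \<open>\<zeta>\<^sub>r = e(r/n)\<close>, \<open>z = 1 + a/m\<close> and \<open>w\<^sub>r = 1 + (a - \<zeta>\<^sub>r)/m\<close>. In Euler's
  limit formula for Gamma, the quotient \<open>\<Prod>\<^sub>r \<Gamma>(w\<^sub>r) / \<Gamma>(z)\<^sup>n\<close> is the limit of partial products of
  \<open>(z + j)\<^sup>n / \<Prod>\<^sub>r (w\<^sub>r + j)\<close>: the factorials cancel, and so do the exponential factors since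
  \<open>\<Sum>\<^sub>r \<zeta>\<^sub>r = 0\<close> for \<open>n \<ge> 2\<close>. With \<open>k = a + m (j + 1)\<close> one has \<open>z + j = k/m\<close> and
  \<open>w\<^sub>r + j = (k - \<zeta>\<^sub>r)/m\<close>, so the factorisation \<open>\<Prod>\<^sub>r (k - \<zeta>\<^sub>r) = k\<^sup>n - 1\<close> turns each factor into the
  Euler factor \<open>1 / (1 - k\<^sup>-\<^sup>n)\<close>. This is \<open>progression_Euler_product_LIMSEQ\<close>.
\<close>

section \<open>Euler products for partitions\<close>

lemma partitions_into_empty: "partitions_into {} = {[]}"
  by (auto simp: partitions_into_def partitions_def)

lemma partitions_into_mono: "A \<subseteq> B \<Longrightarrow> partitions_into A \<subseteq> partitions_into B"
  by (auto simp: partitions_into_def)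

lemma split_off_largest_part:
  assumes "sorted_wrt (\<ge>) ps" and "\<forall>p\<in>set ps. p \<le> (b :: nat)"
  shows "replicate (count_list ps b) b @ filter (\<lambda>p. p \<noteq> b) ps = ps"
  using assms
proof (induction ps)
  case (Cons p ps)
  have IH: "replicate (count_list ps b) b @ filter (\<lambda>p. p \<noteq> b) ps = ps"
    using Cons.prems by (intro Cons.IH) auto
  show ?case
  proof (cases "p = b")
    case True
    with IH show ?thesis
      by simp
  next
    case False
    with Cons.prems have "b \<notin> set (p # ps)"
      by fastforce
    then have "count_list (p # ps) b = 0" "filter (\<lambda>q. q \<noteq> b) (p # ps) = p # ps"
      by (rule count_notin, intro filter_True) auto
    then show ?thesis
      by (simp only: replicate_0 append_Nil)
  qed
qed simp

lemma bij_betw_prepend_largest_part: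
  assumes "\<forall>a\<in>A. a < b" and "b > 0"
  shows "bij_betw (\<lambda>(i, ps). replicate i b @ ps) (UNIV \<times> partitions_into A)
           (partitions_into (insert b A))"
proof (rule bij_betwI')
  fix x y :: "nat \<times> nat list"
  assume xy: "x \<in> UNIV \<times> partitions_into A" "y \<in> UNIV \<times> partitions_into A"
  obtain i ps j qs where [simp]: "x = (i, ps)" "y = (j, qs)"
    by (metis prod.exhaust)
  have b: "b \<notin> set ps" "b \<notin> set qs"
    using assms xy by (auto simp: partitions_into_def)
  have "count_list (replicate k b @ rs) b = k" if "b \<notin> set rs" for k rs
    using that by (induction k) auto
  with b have "i = j" if "replicate i b @ ps = replicate j b @ qs"
    using that by metis
  then show "(case x of (i, ps) \<Rightarrow> replicate i b @ ps) = (case y of (i, ps) \<Rightarrow> replicate i b @ ps)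
      \<longleftrightarrow> x = y"
    by auto
next
  fix x :: "nat \<times> nat list"
  have "sorted_wrt (\<ge>) (replicate i b)" for i
    by (induction i) auto
  moreover assume "x \<in> UNIV \<times> partitions_into A"
  ultimately show "(case x of (i, ps) \<Rightarrow> replicate i b @ ps) \<in> partitions_into (insert b A)"
    using assms
    by (auto simp: partitions_into_def partitions_def sorted_wrt_append less_imp_le subset_iff)
next
  fix qs
  assume qs: "qs \<in> partitions_into (insert b A)"
  define x where "x = (count_list qs b, filter (\<lambda>p. p \<noteq> b) qs)"
  have "x \<in> UNIV \<times> partitions_into A"
    using qs by (auto simp: x_def partitions_into_def partitions_def sorted_wrt_filter)
  moreover have "qs = (case x of (i, ps) \<Rightarrow> replicate i b @ ps)"
  proof -
    have "\<forall>p\<in>set qs. p \<le> b"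
      using qs assms by (fastforce simp: partitions_into_def less_imp_le)
    then show ?thesis
      using split_off_largest_part[of qs b] qs
      by (simp add: x_def partitions_into_def partitions_def)
  qed
  ultimately show "\<exists>x\<in>UNIV \<times> partitions_into A. qs = (case x of (i, ps) \<Rightarrow> replicate i b @ ps)"
    by blast
qed

text \<open>
  The case of finitely many parts, by induction on the largest part \<open>b\<close>: a partition splits into
  some number of copies of \<open>b\<close>, contributing a geometric series, and a partition into smaller parts.
\<close>

lemma has_sum_partitions_into_finite:
  fixes g :: "nat \<Rightarrow> real"
  assumes "finite M" and "\<And>k. k \<in> M \<Longrightarrow> k > 0"
    and "\<And>k. k \<in> M \<Longrightarrow> 0 \<le> g k" and "\<And>k. k \<in> M \<Longrightarrow> g k < 1"
  shows "((\<lambda>ps. prod_list (map g ps)) has_sum (\<Prod>k\<in>M. 1 / (1 - g k))) (partitions_into M)"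
  using assms
proof (induction M rule: finite_linorder_max_induct)
  case empty
  then show ?case
    by (simp add: partitions_into_empty has_sum_finite_iff)
next
  case (insert b A)
  let ?F = "\<lambda>ps. prod_list (map g ps)"
  let ?P = "\<Prod>k\<in>A. 1 / (1 - g k)"
  have IH: "(?F has_sum ?P) (partitions_into A)"
    using insert by simp
  have b: "0 \<le> g b" "g b < 1" "b > 0"
    using insert.prems by auto
  have F_nonneg: "?F ps \<ge> 0" if "ps \<in> partitions_into A" for ps
    using that insert.prems by (intro prod_list_nonneg) (auto simp: partitions_into_def)
  have geom: "((\<lambda>i. g b ^ i) has_sum (1 / (1 - g b))) UNIV"
    using b geometric_sums[of "g b"] by (intro sums_nonneg_imp_has_sum) auto
  have inner: "((\<lambda>ps. g b ^ i * ?F ps) has_sum (g b ^ i * ?P)) (partitions_into A)" for i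
    by (intro has_sum_cmult_right IH)
  have outer: "((\<lambda>i. g b ^ i * ?P) has_sum (1 / (1 - g b) * ?P)) UNIV"
    by (intro has_sum_cmult_left geom)
  have "((\<lambda>(i, ps). g b ^ i * ?F ps) has_sum (1 / (1 - g b) * ?P)) (UNIV \<times> partitions_into A)"
  proof (rule has_sum_SigmaI)
    show "(\<lambda>(i, ps). g b ^ i * ?F ps) summable_on UNIV \<times> partitions_into A"
    proof (rule summable_on_SigmaI)
      show "(\<lambda>i. g b ^ i * ?P) summable_on UNIV"
        using outer by (rule has_sum_imp_summable)
    qed (use inner b F_nonneg in auto)
  qed (use inner outer in auto)
  also have "?this \<longleftrightarrow> ((\<lambda>x. ?F (case x of (i, ps) \<Rightarrow> replicate i b @ ps))
      has_sum (1 / (1 - g b) * ?P)) (UNIV \<times> partitions_into A)"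
    by (intro has_sum_cong) auto
  also have "\<dots> \<longleftrightarrow> (?F has_sum (1 / (1 - g b) * ?P)) (partitions_into (insert b A))"
    using insert.hyps b
    by (intro has_sum_reindex_bij_betw bij_betw_prepend_largest_part) auto
  finally show ?case
    using insert.hyps by (subst prod.insert) auto
qed

text \<open>
  The infinite Euler product. As all terms are nonnegative, the sum over all partitions is the
  supremum of the sums over partitions into the first \<open>N\<close> available parts.
\<close>

lemma has_sum_partitions_into_range:
  fixes g :: "nat \<Rightarrow> real" and k :: "nat \<Rightarrow> nat"
  assumes "inj k" and k: "\<And>i. k i > 0" and g: "\<And>i. 0 \<le> g (k i)" "\<And>i. g (k i) < 1"
    and lim: "(\<lambda>N. \<Prod>i<N. 1 / (1 - g (k i))) \<longlonglongrightarrow> L"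
  shows "((\<lambda>ps. prod_list (map g ps)) has_sum L) (partitions_into (range k))"
proof -
  let ?F = "\<lambda>ps. prod_list (map g ps)"
  let ?E = "\<lambda>N. \<Prod>i<N. 1 / (1 - g (k i))"
  have E: "(?F has_sum ?E N) (partitions_into (k ` {..<N}))" for N
  proof -
    have "(?F has_sum (\<Prod>p\<in>k ` {..<N}. 1 / (1 - g p))) (partitions_into (k ` {..<N}))"
      by (rule has_sum_partitions_into_finite) (use k g in auto)
    moreover have "(\<Prod>p\<in>k ` {..<N}. 1 / (1 - g p)) = ?E N"
      using \<open>inj k\<close> by (subst prod.reindex) (auto intro: inj_on_subset)
    ultimately show ?thesis
      by (simp only:)
  qed
  have nonneg: "?F ps \<ge> 0" if "ps \<in> partitions_into (range k)" for ps
    using that g by (intro prod_list_nonneg) (auto simp: partitions_into_def)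
  have sub: "partitions_into (k ` {..<N}) \<subseteq> partitions_into (range k)" for N
    by (intro partitions_into_mono) auto
  have "incseq ?E"
  proof (rule incseq_SucI)
    fix N
    show "?E N \<le> ?E (Suc N)"
    proof (rule has_sum_mono_neutral[OF E E])
      have "partitions_into (k ` {..<N}) \<subseteq> partitions_into (k ` {..<Suc N})"
        by (intro partitions_into_mono) auto
      then show "?F ps \<le> 0" if "ps \<in> partitions_into (k ` {..<N}) - partitions_into (k ` {..<Suc N})" for ps
        using that by blast
      show "0 \<le> ?F ps" if "ps \<in> partitions_into (k ` {..<Suc N}) - partitions_into (k ` {..<N})" for ps
        using that sub[of "Suc N"] by (intro nonneg) blast
    qed auto
  qed
  then have E_le: "?E N \<le> L" for N
    using lim by (rule incseq_le)
  \<comment> \<open>Finitely many partitions involve only finitely many parts.\<close>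
  have bound: "sum ?F X \<le> L" if X: "finite X" "X \<subseteq> partitions_into (range k)" for X
  proof -
    have "finite (\<Union>ps\<in>X. set ps)" "(\<Union>ps\<in>X. set ps) \<subseteq> range k"
      using X by (auto simp: partitions_into_def)
    then obtain I where "finite I" and I: "(\<Union>ps\<in>X. set ps) = k ` I"
      by (meson finite_subset_image)
    then obtain N where N: "I \<subseteq> {..<N}"
      using finite_nat_iff_bounded by blast
    have "X \<subseteq> partitions_into (k ` {..<N})"
    proof
      fix ps assume ps: "ps \<in> X"
      then have "set ps \<subseteq> k ` I"
        using I by blast
      also have "\<dots> \<subseteq> k ` {..<N}"
        using N by blast
      finally show "ps \<in> partitions_into (k ` {..<N})"
        using ps X by (auto simp: partitions_into_def)
    qed
    then have "sum ?F X \<le> ?E N"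
      using X(1) sub[of N] nonneg by (intro finite_sum_le_has_sum[OF E]) auto
    with E_le[of N] show ?thesis
      by linarith
  qed
  have summable: "?F summable_on partitions_into (range k)"
    by (rule nonneg_bdd_above_summable_on) (use nonneg bound in \<open>auto intro!: bdd_aboveI[of _ L]\<close>)
  then have "infsum ?F (partitions_into (range k)) \<le> L"
    by (intro has_sum_le_finite_sums[OF has_sum_infsum] bound)
  moreover have "L \<le> infsum ?F (partitions_into (range k))"
  proof (rule LIMSEQ_le_const2[OF lim], intro exI allI impI)
    fix N
    show "?E N \<le> infsum ?F (partitions_into (range k))"
      by (rule has_sum_mono_neutral[OF E has_sum_infsum[OF summable]]) (use sub nonneg in auto)
  qed
  ultimately show ?thesis
    using summable by (simp add: has_sum_iff)
qed


section \<open>Roots of unity\<close>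

lemma bij_betw_e_roots_unity:
  assumes "n > 0"
  shows "bij_betw (\<lambda>r. e (of_nat r / of_nat n)) {..<n} {z. z ^ n = 1}"
proof -
  have "e (of_nat r / of_nat n) = cis (2 * pi * real r / real n)" for r
    by (simp add: e_def cis_conv_exp mult_ac)
  then show ?thesis
    using Complex.bij_betw_roots_unity[OF assms] by simp
qed

lemma sum_e_roots_unity:
  assumes "n \<ge> 2"
  shows "(\<Sum>r<n. e (of_nat r / of_nat n)) = 0"
  using sum.reindex_bij_betw[OF bij_betw_e_roots_unity, of n "\<lambda>z. z"] sum_roots_unity[of n] assms
  by simp

lemma prod_diff_roots_unity:
  fixes x :: complex
  assumes "n > 0"
  shows "(\<Prod>z | z ^ n = 1. x - z) = x ^ n - 1"
proof -
  define p :: "complex poly" where "p = monom 1 n - 1"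
  have poly_p: "poly p z = z ^ n - 1" for z
    by (simp add: p_def poly_monom)
  \<comment> \<open>The only possible root of the derivative is \<open>0\<close>, which is not a root of \<open>p\<close>.\<close>
  have "rsquarefree p"
    unfolding rsquarefree_roots
  proof (intro allI notI)
    fix z assume "poly p z = 0 \<and> poly (pderiv p) z = 0"
    then have "z ^ n = 1" "z = 0"
      using assms by (auto simp: poly_p p_def pderiv_diff pderiv_monom poly_monom)
    then show False
      using assms by (simp add: zero_power)
  qed
  moreover have "lead_coeff p = 1"
  proof -
    have "degree p = n"
      unfolding p_def diff_conv_add_uminus
      by (subst degree_add_eq_left) (use assms in \<open>auto simp: degree_monom_eq\<close>)
    then show ?thesis
      using assms by (simp add: p_def)
  qed
  ultimately have "(\<Prod>z | poly p z = 0. [:-z, 1:]) = p"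
    using complex_poly_decompose_rsquarefree[of p] by simp
  then have "poly (\<Prod>z | poly p z = 0. [:-z, 1:]) x = poly p x"
    by simp
  then show ?thesis
    by (simp add: poly_prod poly_p)
qed

lemma prod_diff_e_roots_unity:
  fixes x :: complex
  assumes "n > 0"
  shows "(\<Prod>r<n. x - e (of_nat r / of_nat n)) = x ^ n - 1"
  using prod.reindex_bij_betw[OF bij_betw_e_roots_unity[OF assms], of "\<lambda>z. x - z"]
    prod_diff_roots_unity[OF assms] by simp


section \<open>The Gamma quotient as an Euler product\<close>

text \<open>
  Since the arguments \<open>w r\<close> have mean \<open>z\<close>, the exponential factors of numerator and denominator
  agree and the quotient is a quotient of Pochhammer symbols. As division by \<open>0\<close> yields \<open>0\<close>, no condition on
  poles is needed.
\<close>

lemma Gamma_series_quotient: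
  fixes z :: complex
  assumes w: "(\<Sum>r<n. w r) = of_nat n * z"
  shows "(\<Prod>r<n. Gamma_series (w r) N) / Gamma_series z N ^ n =
         (\<Prod>j\<le>N. (z + of_nat j) ^ n / (\<Prod>r<n. w r + of_nat j))"
proof -
  let ?l = "complex_of_real (ln (of_nat N))"
  have poch: "pochhammer u (N + 1) = (\<Prod>j\<le>N. u + of_nat j)" for u :: complex
    by (simp add: pochhammer_Suc_prod atLeast0AtMost)
  have "(\<Prod>r<n. exp (w r * ?l)) = exp (\<Sum>r<n. w r * ?l)"
    by (simp add: exp_sum)
  also have "\<dots> = exp (z * ?l) ^ n"
    by (simp add: w mult.assoc exp_of_nat_mult flip: sum_distrib_right)
  finally have ex: "(\<Prod>r<n. exp (w r * ?l)) = exp (z * ?l) ^ n" .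
  have "(\<Prod>r<n. Gamma_series (w r) N) / Gamma_series z N ^ n =
        pochhammer z (N + 1) ^ n / (\<Prod>r<n. pochhammer (w r) (N + 1))"
    unfolding Gamma_series_def prod_dividef prod.distrib ex
    by (simp add: power_divide power_mult_distrib)
  also have "\<dots> = (\<Prod>j\<le>N. (z + of_nat j) ^ n) / (\<Prod>j\<le>N. \<Prod>r<n. w r + of_nat j)"
    unfolding poch by (subst prod.swap) (simp add: prod_power_distrib)
  also have "\<dots> = (\<Prod>j\<le>N. (z + of_nat j) ^ n / (\<Prod>r<n. w r + of_nat j))"
    by (simp add: prod_dividef)
  finally show ?thesis .
qed

text \<open>
  For \<open>(a, m) = (0, 1)\<close> this still holds, the nonempty partial products and the limit being \<open>0\<close>:
  the factor \<open>j = 0\<close> and the value of Gamma at its pole \<open>0\<close> are both the default value \<open>0\<close>.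
\<close>

lemma progression_Euler_product_LIMSEQ:
  fixes a m n :: nat
  assumes m: "m \<ge> 1" and "n \<ge> 2"
  shows "(\<lambda>N. \<Prod>j<N. 1 / (1 - 1 / (of_nat (a + m * Suc j) :: complex) ^ n)) \<longlonglongrightarrow>
    Gamma (1 + of_nat a / of_nat m) powi (- int n) *
      (\<Prod>r<n. Gamma (1 + (of_nat a - e (of_nat r / of_nat n)) / of_nat m))"
    (is "?E \<longlonglongrightarrow> ?G")
proof -
  define z :: complex where "z = 1 + of_nat a / of_nat m"
  define w where "w r = 1 + (of_nat a - e (of_nat r / of_nat n)) / of_nat m" for r
  have "z = of_real (1 + real a / real m)"
    by (simp add: z_def)
  moreover have "1 + real a / real m > 0"
    by (simp add: add_pos_nonneg)
  ultimately have "z \<notin> \<int>\<^sub>\<le>\<^sub>0"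
    by (metis nonpos_Ints_nonpos not_less of_real_in_nonpos_Ints_iff)
  then have Gz: "Gamma z \<noteq> 0"
    by (simp add: Gamma_eq_zero_iff)
  have w: "(\<Sum>r<n. w r) = of_nat n * z"
  proof -
    have "w r = z - e (of_nat r / of_nat n) / of_nat m" for r
      by (simp add: w_def z_def diff_divide_distrib)
    then show ?thesis
      using sum_e_roots_unity[OF \<open>n \<ge> 2\<close>] by (simp add: sum_subtractf flip: sum_divide_distrib)
  qed
  have factor: "(z + of_nat j) ^ n / (\<Prod>r<n. w r + of_nat j) =
      1 / (1 - 1 / of_nat (a + m * Suc j) ^ n)" for j
  proof -
    define k :: complex where "k = of_nat (a + m * Suc j)"
    have "a + m * Suc j \<noteq> 0"
      using m by simp
    then have "k \<noteq> 0"
      unfolding k_def of_nat_eq_0_iff .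
    have zj: "z + of_nat j = k / of_nat m"
      using m by (simp add: z_def k_def field_simps)
    have wj: "w r + of_nat j = (k - e (of_nat r / of_nat n)) / of_nat m" for r
      using m by (simp add: w_def k_def field_simps)
    have "(z + of_nat j) ^ n / (\<Prod>r<n. w r + of_nat j) = k ^ n / (k ^ n - 1)"
      unfolding zj wj using m \<open>n \<ge> 2\<close>
      by (simp add: prod_dividef power_divide prod_diff_e_roots_unity)
    also have "\<dots> = 1 / ((k ^ n - 1) / k ^ n)"
      by simp
    also have "(k ^ n - 1) / k ^ n = 1 - 1 / k ^ n"
      using \<open>k \<noteq> 0\<close> by (simp add: diff_divide_distrib)
    finally show ?thesis
      by (simp add: k_def)
  qed
  have "(\<lambda>N. (\<Prod>r<n. Gamma_series (w r) N) / Gamma_series z N ^ n) \<longlonglongrightarrow>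
      (\<Prod>r<n. Gamma (w r)) / Gamma z ^ n"
    using Gz by (intro tendsto_intros) auto
  also have "(\<lambda>N. (\<Prod>r<n. Gamma_series (w r) N) / Gamma_series z N ^ n) = (\<lambda>N. ?E (Suc N))"
    unfolding Gamma_series_quotient[OF w] factor lessThan_Suc_atMost ..
  finally have "?E \<longlonglongrightarrow> (\<Prod>r<n. Gamma (w r)) / Gamma z ^ n"
    by (rule LIMSEQ_imp_Suc)
  also have "(\<Prod>r<n. Gamma (w r)) / Gamma z ^ n = ?G"
    by (simp add: w_def z_def power_int_minus field_simps)
  finally show ?thesis .
qed


section \<open>The partition zeta function of a progression\<close>

lemma zeta_term_of_nat:
  assumes "\<forall>p\<in>set ps. p > 0"
  shows "zeta_term (of_nat n) ps = of_real (prod_list (map (\<lambda>k. 1 / real k ^ n) ps))"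
proof -
  have "prod_list ps > 0"
    using assms by (induction ps) auto
  then have "zeta_term (of_nat n) ps = of_real (1 / real (prod_list ps) ^ n)"
    by (simp add: zeta_term_def partition_norm_def powr_minus powr_nat' divide_simps)
  also have "1 / real (prod_list ps) ^ n = prod_list (map (\<lambda>k. 1 / real k ^ n) ps)"
  proof (induction ps)
    case (Cons p ps)
    then show ?case
      by (simp add: power_mult_distrib flip: Cons)
  qed simp
  finally show ?thesis .
qed

theorem theorem1:
  fixes a m n :: nat
  assumes "m \<ge> 1" and "(a, m) \<noteq> (0, 1)" and "n \<ge> 2"
  shows "partition_zeta_converges (partitions_into (progression a m)) (of_nat n) \<and>
    partition_zeta (partitions_into (progression a m)) (of_nat n) =
      Gamma (1 + of_nat a / of_nat m :: complex) powi (- int n) *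
      (\<Prod>r<n. Gamma (1 + (of_nat a - e (of_nat r / of_nat n)) / of_nat m))"
proof -
  define k where "k j = a + m * Suc j" for j
  define g where "g = (\<lambda>p. 1 / real p ^ n)"
  define G where "G = Gamma (1 + of_nat a / of_nat m :: complex) powi (- int n) *
      (\<Prod>r<n. Gamma (1 + (of_nat a - e (of_nat r / of_nat n)) / of_nat m))"
  \<comment> \<open>The value \<open>G\<close> is real, as a limit of real products.\<close>
  define L where "L = Re G"
  have k: "k j \<ge> 2" for j
  proof -
    have "m * Suc j \<ge> m" by simp
    then show ?thesis
      using assms by (cases "a = 0") (auto simp: k_def)
  qed
  have "inj k"
    using assms by (auto simp: inj_on_def k_def)
  have range: "progression a m = range k"
  proof (intro equalityI subsetI)
    fix p assume "p \<in> progression a m"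
    then obtain j where "p = a + m * j" "j \<ge> 1"
      by (auto simp: progression_def)
    then have "p = k (j - 1)"
      by (simp add: k_def)
    then show "p \<in> range k"
      by (rule range_eqI)
  next
    fix p assume "p \<in> range k"
    then obtain j where "p = a + m * Suc j"
      by (auto simp: k_def)
    then show "p \<in> progression a m"
      unfolding progression_def by (intro CollectI exI[of _ "Suc j"]) auto
  qed
  have g: "0 \<le> g (k i)" "g (k i) < 1" for i
  proof -
    have "1 < real (k i) ^ n"
      using k[of i] assms by (intro one_less_power) auto
    then show "g (k i) < 1"
      by (simp add: g_def divide_less_eq)
    show "0 \<le> g (k i)"
      by (simp add: g_def)
  qed
  have lim: "(\<lambda>N. complex_of_real (\<Prod>j<N. 1 / (1 - g (k j)))) \<longlonglongrightarrow> G"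
    using progression_Euler_product_LIMSEQ[OF assms(1,3), of a] by (simp add: G_def g_def k_def)
  have lim_real: "(\<lambda>N. \<Prod>j<N. 1 / (1 - g (k j))) \<longlonglongrightarrow> L"
    using tendsto_Re[OF lim] by (simp only: L_def Re_complex_of_real)
  have "G = of_real L"
    by (rule LIMSEQ_unique[OF lim tendsto_of_real[OF lim_real]])
  moreover have "((\<lambda>ps. complex_of_real (prod_list (map g ps))) has_sum of_real L)
      (partitions_into (range k))"
    using k g by (intro has_sum_of_real has_sum_partitions_into_range[OF \<open>inj k\<close>] lim_real)
      (auto intro: less_le_trans[of 0 2])
  moreover have "zeta_term (of_nat n) ps = of_real (prod_list (map g ps))"
    if "ps \<in> partitions_into (range k)" for ps
    using that zeta_term_of_nat[of ps n]
    by (auto simp: partitions_into_def partitions_def g_def Suc_le_eq)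
  ultimately have "(zeta_term (of_nat n) has_sum G) (partitions_into (progression a m))"
    unfolding range by (metis (no_types, lifting) has_sum_cong)
  then show ?thesis
    unfolding partition_zeta_converges_def partition_zeta_def G_def has_sum_iff .
qed

end
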